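(* Let $\tau=(\sqrt5+1)/2$, and consider the following five maps: (1) the Farey map on $[0,1]$, $x\mapsto\min\bigl(x(1-x)^{-1},(1-x)x^{-1}\bigr)$; (2) the Ceiling map on $[0,1]$, $x\mapsto -x^{-1}+\lceil x^{-1}\rceil$; (3) the unfolded Even map on $[-1,1]$, $x\mapsto |x^{-1}|-(\text{the even integer nearest to }|x^{-1}|)$; (4) the unfolded Odd map on $[-1,1]$, $x\mapsto |x^{-1}|-(\text{the odd integer nearest to }|x^{-1}|)$; (5) the Nearest Integer map on $[-1/2,1/2]$, $x\mapsto |x^{-1}|-(\text{the integer nearest to }|x^{-1}|)$. Let $\omega$ be a quadratic irrational in the domain of one of the maps (1)--(5). Then $\omega$ is purely periodic under the map if and only if its Galois conjugate $\omega'$ satisfies, respectively, the following inequalities: (1) $\omega'<0$; (2) $\omega'>1$; (3) $\omega'<-1$; (4) $\omega'\le-\tau-1$ in case $\omega<0$, or $\omega'\le-\tau+1$ in case $\omega>0$; (5) $\omega'\le-\tau-1$ in case $\omega<0$, or $\omega'\le-\tau$ in case $\omega>0$.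
   Context: A quadratic irrational is a real irrational root of a quadratic polynomial with rational coefficients; its Galois conjugate $\omega'$ is the other root. A point $\omega$ is purely periodic under a map $T$ if $T^p(\omega)=\omega$ for some $p\ge1$. The maps are considered along orbits of irrational points, so the values at $0$ and at points where the "nearest integer" is ambiguous (all of them rational) are irrelevant. *)

theory Defs
  imports Complex_Main "HOL-Computational_Algebra.Polynomial"
begin

section \<open>Quadratic irrationals and their Galois conjugates\<close>

definition quadratic_root :: "rat poly \<Rightarrow> real \<Rightarrow> bool" where
  "quadratic_root p x \<longleftrightarrow> degree p = 2 \<and> poly (map_poly of_rat p) x = 0"

definition quadratic_irrational :: "real \<Rightarrow> bool" where
  "quadratic_irrational x \<longleftrightarrow> x \<notin> \<rat> \<and> (\<exists>p. quadratic_root p x)"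

definition galois_conjugate :: "real \<Rightarrow> real" where
  "galois_conjugate x = (THE y. y \<noteq> x \<and> (\<exists>p. quadratic_root p x \<and> quadratic_root p y))"

lemma quadratic_root_altdef:
  "quadratic_root p x \<longleftrightarrow> (\<exists>a b c. p = [:c, b, a:] \<and> a \<noteq> 0 \<and>
     of_rat a * x\<^sup>2 + of_rat b * x + of_rat c = 0)"
proof
  assume *: "quadratic_root p x"
  then have deg: "degree p = 2" by (simp add: quadratic_root_def)
  define a b c where "a = coeff p 2" and "b = coeff p 1" and "c = coeff p 0"
  have p: "p = [:c, b, a:]"
  proof (rule poly_eqI)
    fix n show "coeff p n = coeff [:c, b, a:] n"
      using deg by (auto simp: a_def b_def c_def coeff_pCons coeff_eq_0 numeral_2_eq_2 split: nat.splits)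
  qed
  have a: "a \<noteq> 0" using deg by (metis a_def leading_coeff_0_iff degree_0 zero_neq_numeral)
  show "\<exists>a b c. p = [:c, b, a:] \<and> a \<noteq> 0 \<and> of_rat a * x\<^sup>2 + of_rat b * x + of_rat c = 0"
    using * a unfolding quadratic_root_def p
    by (intro exI[of _ a] exI[of _ b] exI[of _ c])
       (simp add: map_poly_pCons algebra_simps power2_eq_square)
next
  assume "\<exists>a b c. p = [:c, b, a:] \<and> a \<noteq> 0 \<and> of_rat a * x\<^sup>2 + of_rat b * x + of_rat c = 0"
  then show "quadratic_root p x"
    by (auto simp: quadratic_root_def map_poly_pCons algebra_simps power2_eq_square)
qed

lemma other_root_iff:
  assumes x: "x \<notin> \<rat>" and a: "a \<noteq> 0"
    and root: "of_rat a * x\<^sup>2 + of_rat b * x + of_rat c = 0"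
  shows "y \<noteq> x \<and> (\<exists>p. quadratic_root p x \<and> quadratic_root p y) \<longleftrightarrow>
         y = - of_rat (b / a) - x"
proof
  let ?y = "- of_rat (b / a) - x"
  have "?y \<noteq> x"
  proof
    assume "?y = x"
    then have "x = of_rat (- (b / a) / 2)"
      by (simp add: of_rat_divide of_rat_minus of_rat_mult)
    with x show False by (metis Rats_of_rat)
  qed
  moreover have "of_rat a * ?y\<^sup>2 + of_rat b * ?y + of_rat c = (0::real)"
  proof -
    define r :: real where "r = of_rat (b / a)"
    have b: "of_rat b = of_rat a * r"
      using a by (simp add: r_def of_rat_divide)
    have "of_rat a * ?y\<^sup>2 + of_rat b * ?y + of_rat c = of_rat a * x\<^sup>2 + of_rat b * x + of_rat c"
      unfolding r_def[symmetric] b by (simp add: power2_eq_square algebra_simps)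
    then show ?thesis using root by simp
  qed
  moreover from this have "quadratic_root [:c, b, a:] ?y"
    using a by (auto simp only: quadratic_root_altdef)
  moreover have "quadratic_root [:c, b, a:] x"
    using a root by (auto simp only: quadratic_root_altdef)
  moreover assume "y = ?y"
  ultimately show "y \<noteq> x \<and> (\<exists>p. quadratic_root p x \<and> quadratic_root p y)"
    by metis
next
  assume y: "y \<noteq> x \<and> (\<exists>p. quadratic_root p x \<and> quadratic_root p y)"
  then obtain a' b' c' where a': "a' \<noteq> 0"
    and rx: "of_rat a' * x\<^sup>2 + of_rat b' * x + of_rat c' = 0"
    and ry: "of_rat a' * y\<^sup>2 + of_rat b' * y + of_rat c' = 0"
    by (force simp: quadratic_root_altdef)
  have "(of_rat a' * (x + y) + of_rat b') * (x - y) = 0"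
    using rx ry by (simp add: algebra_simps power2_eq_square)
  then have sy: "of_rat a' * (x + y) + of_rat b' = 0" using y by simp
  have lin: "of_rat (a' * b - a * b') * x = of_rat (a * c' - a' * c)"
  proof -
    have "of_rat a' * (of_rat a * x\<^sup>2 + of_rat b * x + of_rat c)
        - of_rat a * (of_rat a' * x\<^sup>2 + of_rat b' * x + of_rat c') = 0"
      using root rx by simp
    then show ?thesis
      by (simp add: of_rat_diff of_rat_mult algebra_simps)
  qed
  have "a' * b - a * b' = 0"
  proof (rule ccontr)
    assume ne: "a' * b - a * b' \<noteq> 0"
    then have "x = of_rat ((a * c' - a' * c) / (a' * b - a * b'))"
      using lin by (subst of_rat_divide) (metis nonzero_mult_div_cancel_left of_rat_eq_0_iff)
    with x show False by (metis Rats_of_rat)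
  qed
  then have "b / a = b' / a'" using a a' by (simp add: field_simps)
  moreover have "y = - of_rat (b' / a') - x"
    using sy a' by (simp add: of_rat_divide field_simps)
  ultimately show "y = - of_rat (b / a) - x" by simp
qed

lemma galois_conjugate_ex1:
  assumes "quadratic_irrational x"
  shows "\<exists>!y. y \<noteq> x \<and> (\<exists>p. quadratic_root p x \<and> quadratic_root p y)"
proof -
  obtain a b c where "x \<notin> \<rat>" "a \<noteq> 0" "of_rat a * x\<^sup>2 + of_rat b * x + of_rat c = 0"
    using assms by (auto simp: quadratic_irrational_def quadratic_root_altdef)
  from other_root_iff[OF this] show ?thesis by auto
qed

lemma galois_conjugate_eq:
  assumes "x \<notin> \<rat>" "a \<noteq> 0" "of_rat a * x\<^sup>2 + of_rat b * x + of_rat c = 0"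
  shows "galois_conjugate x = - of_rat (b / a) - x"
  unfolding galois_conjugate_def other_root_iff[OF assms] by simp


section \<open>The maps\<close>

text \<open>
  All maps are total functions on the reals. Their values at 0 (where \<open>inverse 0 = 0\<close>) and at
  points with two equidistant integers of the relevant kind are junk; such points are rational.
\<close>

definition purely_periodic :: "(real \<Rightarrow> real) \<Rightarrow> real \<Rightarrow> bool" where
  "purely_periodic T x \<longleftrightarrow> (\<exists>p\<ge>1. (T ^^ p) x = x)"

definition nearest :: "(int \<Rightarrow> bool) \<Rightarrow> real \<Rightarrow> int" where
  "nearest P y = (ARG_MIN (\<lambda>n. \<bar>y - of_int n\<bar>) n. P n)"

lemma nearest_eqI:
  assumes "P n" and "\<And>m. P m \<Longrightarrow> m \<noteq> n \<Longrightarrow> \<bar>y - of_int n\<bar> < \<bar>y - of_int m\<bar>"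
  shows "nearest P y = n"
  unfolding nearest_def
proof (rule arg_minI[where P = P and x = n])
  show "\<not> \<bar>y - of_int m\<bar> < \<bar>y - of_int n\<bar>" if "P m" for m
    using assms(2)[OF that] by fastforce
  show "k = n" if "P k" "\<forall>m. P m \<longrightarrow> \<not> \<bar>y - of_int m\<bar> < \<bar>y - of_int k\<bar>" for k
    using that assms by blast
qed (fact assms(1))

lemma irrational_round_less:
  fixes y :: real
  assumes "y \<notin> \<rat>" "m \<noteq> round y"
  shows "\<bar>y - of_int (round y)\<bar> < \<bar>y - of_int m\<bar>"
proof -
  have "\<bar>y - of_int (round y)\<bar> \<le> \<bar>y - of_int m\<bar>"
    using round_diff_minimal[of y m] by simp
  moreover have "\<bar>y - of_int (round y)\<bar> \<noteq> \<bar>y - of_int m\<bar>"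
  proof
    assume "\<bar>y - of_int (round y)\<bar> = \<bar>y - of_int m\<bar>"
    with assms(2) have "y = (of_int (round y) + of_int m) / 2"
      by (auto simp: abs_if split: if_splits)
    also have "\<dots> \<in> \<rat>" by simp
    finally show False using assms(1) by simp
  qed
  ultimately show ?thesis by simp
qed

lemma nearest_even_irrational:
  assumes "y \<notin> \<rat>"
  shows "nearest even y = 2 * round (y / 2)"
proof (rule nearest_eqI)
  fix m :: int
  assume "even m" and ne: "m \<noteq> 2 * round (y / 2)"
  then obtain k where m: "m = 2 * k" by blast
  have "y / 2 \<notin> \<rat>"
  proof
    assume "y / 2 \<in> \<rat>"
    then have "2 * (y / 2) \<in> \<rat>" by (intro Rats_mult) auto
    with assms show False by simp
  qed
  from irrational_round_less[OF this, of k] ne m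
  show "\<bar>y - of_int (2 * round (y / 2))\<bar> < \<bar>y - of_int m\<bar>"
    by (simp add: abs_if split: if_splits)
qed simp

lemma nearest_odd_irrational:
  assumes "y \<notin> \<rat>"
  shows "nearest odd y = 2 * round ((y - 1) / 2) + 1"
proof (rule nearest_eqI)
  fix m :: int
  assume "odd m" and ne: "m \<noteq> 2 * round ((y - 1) / 2) + 1"
  then obtain k where m: "m = 2 * k + 1" by (elim oddE)
  have "(y - 1) / 2 \<notin> \<rat>"
  proof
    assume "(y - 1) / 2 \<in> \<rat>"
    then have "2 * ((y - 1) / 2) + 1 \<in> \<rat>" by (intro Rats_mult Rats_add) auto
    also have "2 * ((y - 1) / 2) + 1 = y" by (simp add: field_simps)
    finally show False using assms by simp
  qed
  from irrational_round_less[OF this, of k] ne m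
  show "\<bar>y - of_int (2 * round ((y - 1) / 2) + 1)\<bar> < \<bar>y - of_int m\<bar>"
    by (simp add: abs_if field_simps split: if_splits)
qed simp

definition farey_map :: "real \<Rightarrow> real" where
  "farey_map x = min (x * inverse (1 - x)) ((1 - x) * inverse x)"

definition ceiling_map :: "real \<Rightarrow> real" where
  "ceiling_map x = - inverse x + of_int \<lceil>inverse x\<rceil>"

definition even_map :: "real \<Rightarrow> real" where
  "even_map x = \<bar>inverse x\<bar> - of_int (nearest even \<bar>inverse x\<bar>)"

definition odd_map :: "real \<Rightarrow> real" where
  "odd_map x = \<bar>inverse x\<bar> - of_int (nearest odd \<bar>inverse x\<bar>)"

definition nearest_integer_map :: "real \<Rightarrow> real" where
  "nearest_integer_map x = \<bar>inverse x\<bar> - of_int (round \<bar>inverse x\<bar>)"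

definition tau :: real where
  "tau = (sqrt 5 + 1) / 2"

end

theory Submission
  imports Defs
begin

text \<open>
  On an irrational point \<open>x\<close> each of the five maps is an integer Moebius transformation
  \<open>z \<mapsto> (a z + b) / (c z + d)\<close> of determinant \<open>\<plusminus>1\<close>, chosen according to \<open>x\<close> and expanding there:
  \<open>\<bar>c x + d\<bar> < 1\<close>. Conjugation commutes with such transformations, so while \<open>\<omega>\<close> moves under
  the map \<open>T\<close>, its conjugate is moved by the same transformations. For every map there is a closed
  half-line attached to each point \<open>x\<close>, here called the fibre over \<open>x\<close>, such that the
  pairs \<open>(x, y)\<close> with \<open>y\<close> in the fibre over \<open>x\<close> form an invariant set of this two-dimensional
  action. The inequalities in the theorem say that \<open>\<omega>'\<close> lies in the fibre over \<open>\<omega>\<close>; whether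
  an inequality with a rational bound is strict does not matter, since \<open>\<omega>'\<close> is irrational.
  Two arguments, common to all the maps, then give the equivalence (\<open>purely_periodic_iff\<close>).

  Suppose that \<open>\<omega>'\<close> lies in the fibre. The whole orbit consists of points whose conjugates lie in
  their fibres, and of one discriminant. A point \<open>x\<close> and the elements of its fibre always have
  different integer parts, and only finitely many pairs of conjugates with this property have a given
  discriminant: this is the classical finiteness of reduced quadratic forms
  (\<open>finite_separated_unit_interval\<close>). On these pairs the action is also injective, and an
  injective map of a finite set to itself has only purely periodic points.

  Suppose that \<open>\<omega>\<close> is purely periodic. The composition of the transformations over one period
  fixes \<open>\<omega>\<close> and \<open>\<omega>'\<close>. It is repelling at \<open>\<omega>\<close>, hence attracting at \<open>\<omega>'\<close>. Any point
  \<open>z \<noteq> \<omega>\<close> of the fibre over \<open>\<omega>\<close> is therefore driven towards \<open>\<omega>'\<close> without leaving the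
  fibre, and \<open>\<omega>'\<close> is in the fibre because the fibre is closed.

  It remains to check invariance and injectivity for each map. For the last three maps, which all
  have the form \<open>x \<mapsto> \<bar>1/x\<bar> - N x\<close>, let \<open>{..-\<beta>}\<close> be the fibre over negative points and
  \<open>{..-\<gamma>}\<close> the fibre over positive points. The image of the fibres before subtraction of the digit
  is contained in \<open>{-1/\<gamma>..1/\<beta>}\<close>. Invariance asks that a digit be at least \<open>\<beta> + 1/\<beta>\<close> when the
  remainder is negative and at least \<open>\<gamma> + 1/\<beta>\<close> when it is positive; injectivity asks that
  distinct digits differ by at least the length \<open>1/\<gamma> + 1/\<beta>\<close>. The smallest digit with a negative
  remainder, the smallest digit with a positive remainder and the digit gap are \<open>(2, 2, 2)\<close> for the
  Even map, \<open>(3, 1, 2)\<close> for the Odd map and \<open>(3, 2, 1)\<close> for the Nearest Integer map, and the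
  values of \<open>(\<beta>, \<gamma>)\<close> with \<open>\<beta> \<ge> 1\<close> making all three conditions equalities are
  \<open>(1, 1)\<close>, \<open>(\<tau> + 1, \<tau> - 1)\<close> and \<open>(\<tau> + 1, \<tau>)\<close>.
\<close>
section \<open>Conjugate pairs and integer Moebius transformations\<close>

text \<open>
  \<open>x\<close> and \<open>y\<close> are the two roots of an integer form of discriminant \<open>D\<close>. Giving the form by its
  elementary symmetric functions makes the notion symmetric in the roots and keeps square roots out.
\<close>
definition conjugate_pair :: "int \<Rightarrow> real \<Rightarrow> real \<Rightarrow> bool" where
  "conjugate_pair D x y \<longleftrightarrow> (\<exists>a b c::int. a \<noteq> 0 \<and> of_int a * (x + y) = - of_int b \<and>
     of_int a * (x * y) = of_int c \<and> b\<^sup>2 - 4 * a * c = D)"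

lemma conjugate_pair_sym: "conjugate_pair D x y \<Longrightarrow> conjugate_pair D y x"
  unfolding conjugate_pair_def by (simp add: add.commute mult.commute)

lemma conjugate_pair_galois:
  assumes "conjugate_pair D x y" and x: "x \<notin> \<rat>"
  shows "quadratic_irrational x" and "galois_conjugate x = y"
proof -
  from assms(1) obtain a b c :: int where a: "a \<noteq> 0"
    and s: "of_int a * (x + y) = - of_int b" and m: "of_int a * (x * y) = of_int c"
    unfolding conjugate_pair_def by blast
  have "of_int a * x\<^sup>2 + of_int b * x + of_int c = of_int a * x * (x + y) + of_int b * x"
    unfolding m[symmetric] by (simp add: power2_eq_square algebra_simps)
  also have "\<dots> = (of_int a * (x + y) + of_int b) * x" by (simp add: algebra_simps)
  also have "\<dots> = 0" using s by simp
  finally have root: "of_rat (of_int a) * x\<^sup>2 + of_rat (of_int b) * x + of_rat (of_int c) = 0"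
    by simp
  show "quadratic_irrational x"
    unfolding quadratic_irrational_def quadratic_root_altdef using x a root
    by (metis of_int_eq_0_iff)
  have "galois_conjugate x = - (of_int b / of_int a) - x"
    using galois_conjugate_eq[OF x _ root] a by (simp add: of_rat_divide)
  moreover have "x + y = - (of_int b / of_int a)"
    using a s by (simp add: eq_divide_eq mult.commute flip: divide_minus_left)
  ultimately show "galois_conjugate x = y" by linarith
qed

lemma conjugate_pair_exists:
  assumes "quadratic_irrational x"
  obtains D where "conjugate_pair D x (galois_conjugate x)"
proof -
  obtain a b c where x: "x \<notin> \<rat>" and a: "a \<noteq> 0"
    and root: "of_rat a * x\<^sup>2 + of_rat b * x + of_rat c = 0"
    using assms by (auto simp: quadratic_irrational_def quadratic_root_altdef)
  obtain p q where q: "q > 0" "a = Fract p q" by (cases a) auto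
  obtain r s where s: "s > 0" "b = Fract r s" by (cases b) auto
  obtain t u where u: "u > 0" "c = Fract t u" by (cases c) auto
  have eqs: "of_rat a = (of_int p / of_int q :: real)"
    "of_rat b = (of_int r / of_int s :: real)" "of_rat c = (of_int t / of_int u :: real)"
    using q s u by (simp_all add: of_rat_rat)
  have p: "p \<noteq> 0" using a q by (auto simp: rat_number_collapse)
  define y where "y = galois_conjugate x"
  have y: "y = - (of_rat b / of_rat a) - x"
    unfolding y_def galois_conjugate_eq[OF x a root] by (simp add: of_rat_divide)
  have ra: "of_rat a \<noteq> (0::real)" using a by simp
  have sum: "of_rat a * (x + y) = - (of_rat b :: real)" using ra unfolding y by (simp add: field_simps)
  have "of_rat a * (x * y) = - (of_rat a * x\<^sup>2 + of_rat b * x)"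
    using ra unfolding y by (simp add: field_simps power2_eq_square)
  then have prod: "of_rat a * (x * y) = (of_rat c :: real)" using root by simp
  have nz: "of_int q \<noteq> (0::real)" "of_int s \<noteq> (0::real)" "of_int u \<noteq> (0::real)"
    using q s u by auto
  have "of_int p * of_int s * (x + y) = - (of_int r * of_int q)"
    using sum nz unfolding eqs by (simp add: field_simps)
  then have "of_int u * (of_int p * of_int s * (x + y)) = of_int u * (- (of_int r * of_int q))"
    by (rule arg_cong)
  then have 1: "of_int (p * s * u) * (x + y) = - of_int (r * q * u)"
    by (simp only: of_int_mult mult_minus_right mult_ac)
  have "of_int p * of_int u * (x * y) = of_int t * of_int q"
    using prod nz unfolding eqs by (simp add: field_simps)
  then have "of_int s * (of_int p * of_int u * (x * y)) = of_int s * (of_int t * of_int q)"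
    by (rule arg_cong)
  then have 2: "of_int (p * s * u) * (x * y) = of_int (t * q * s)"
    by (simp only: of_int_mult mult_ac)
  have 3: "p * s * u \<noteq> 0" using p s u by simp
  have "conjugate_pair ((r*q*u)\<^sup>2 - 4 * (p*s*u) * (t*q*s)) x y"
    unfolding conjugate_pair_def using 1 2 3 by blast
  then show thesis using that unfolding y_def by blast
qed

lemma galois_conjugate_irrational:
  assumes "quadratic_irrational x"
  shows "galois_conjugate x \<notin> \<rat>" and "galois_conjugate x \<noteq> x"
proof -
  obtain a b c where x: "x \<notin> \<rat>" and a: "a \<noteq> 0"
    and root: "of_rat a * x\<^sup>2 + of_rat b * x + of_rat c = 0"
    using assms by (auto simp: quadratic_irrational_def quadratic_root_altdef)
  have eq: "galois_conjugate x = - of_rat (b / a) - x"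
    by (rule galois_conjugate_eq[OF x a root])
  show "galois_conjugate x \<noteq> x" using other_root_iff[OF x a root] eq by blast
  show "galois_conjugate x \<notin> \<rat>"
  proof
    assume "galois_conjugate x \<in> \<rat>"
    then have "- of_rat (b / a) - galois_conjugate x \<in> \<rat>" by (intro Rats_diff) auto
    with x show False unfolding eq by simp
  qed
qed

definition moebius :: "int \<Rightarrow> int \<Rightarrow> int \<Rightarrow> int \<Rightarrow> real \<Rightarrow> real" where
  "moebius a b c d x = (of_int a * x + of_int b) / (of_int c * x + of_int d)"

lemma moebius_denominator_nonzero:
  assumes "\<bar>a * d - b * c\<bar> = 1" and x: "x \<notin> \<rat>"
  shows "of_int c * x + of_int d \<noteq> (0::real)"
proof
  assume 0: "of_int c * x + of_int d = 0"
  show False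
  proof (cases "c = 0")
    case True
    with 0 assms show False by simp
  next
    case False
    with 0 have "x = - of_int d / of_int c" by (simp add: field_simps)
    with x show False by auto
  qed
qed

text \<open>
  The cocycle identity behind all contraction estimates: the factor by which a Moebius transformation
  changes a distance splits into one contribution from each of the two points.
\<close>
lemma moebius_diff:
  assumes "\<bar>a * d - b * c\<bar> = 1"
    and "of_int c * x + of_int d \<noteq> (0::real)" "of_int c * y + of_int d \<noteq> (0::real)"
  shows "\<bar>moebius a b c d x - moebius a b c d y\<bar> *
      (\<bar>of_int c * x + of_int d\<bar> * \<bar>of_int c * y + of_int d\<bar>) = \<bar>x - y\<bar>"
proof -
  have "(moebius a b c d x - moebius a b c d y) *
      ((of_int c * x + of_int d) * (of_int c * y + of_int d)) =
     (of_int a * x + of_int b) * (of_int c * y + of_int d)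
     - (of_int a * y + of_int b) * (of_int c * x + of_int d)"
    using assms(2,3) unfolding moebius_def by (simp add: left_diff_distrib)
  also have "\<dots> = of_int (a * d - b * c) * (x - y)" by (simp add: algebra_simps)
  finally have "\<bar>(moebius a b c d x - moebius a b c d y) *
      ((of_int c * x + of_int d) * (of_int c * y + of_int d))\<bar> = of_int \<bar>a * d - b * c\<bar> * \<bar>x - y\<bar>"
    by (simp only: abs_mult of_int_abs)
  then show ?thesis using assms(1) by (simp add: abs_mult)
qed

lemma moebius_irrational:
  assumes det: "\<bar>a * d - b * c\<bar> = 1" and x: "x \<notin> \<rat>"
  shows "moebius a b c d x \<notin> \<rat>"
proof
  assume r: "moebius a b c d x \<in> \<rat>"
  define r where "r = moebius a b c d x"
  have nz: "of_int c * x + of_int d \<noteq> 0" by (rule moebius_denominator_nonzero[OF assms])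
  then have eq: "of_int a * x + of_int b = r * (of_int c * x + of_int d)"
    unfolding r_def moebius_def by simp
  then have eq': "(of_int a - r * of_int c) * x = r * of_int d - of_int b"
    by (simp add: algebra_simps)
  show False
  proof (cases "of_int a - r * of_int c = 0")
    case True
    then have "of_int a = r * of_int c" "of_int b = r * of_int d" using eq' by auto
    then have "real_of_int (a * d - b * c) = 0" by simp
    with det show False by linarith
  next
    case False
    then have "x = (r * of_int d - of_int b) / (of_int a - r * of_int c)"
      using eq' by (simp add: field_simps)
    moreover have "\<dots> \<in> \<rat>" using r unfolding r_def by (intro Rats_divide Rats_diff Rats_mult) auto
    ultimately show False using x by simp
  qed
qed

text \<open>
  Substituting in a binary quadratic form multiplies its discriminant by the square of the
  determinant, so the image pair belongs to a form of the same discriminant.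
\<close>
lemma conjugate_pair_moebius:
  assumes det: "\<bar>a * d - b * c\<bar> = 1" and pair: "conjugate_pair D x y"
    and nx: "of_int c * x + of_int d \<noteq> (0::real)" and ny: "of_int c * y + of_int d \<noteq> (0::real)"
  shows "conjugate_pair D (moebius a b c d x) (moebius a b c d y)"
proof -
  from pair obtain k l m :: int where k: "k \<noteq> 0" and s: "of_int k * (x + y) = - of_int l"
    and p: "of_int k * (x * y) = of_int m" and D: "l\<^sup>2 - 4 * k * m = D"
    unfolding conjugate_pair_def by blast
  \<comment> \<open>The form obtained by substituting the adjugate matrix; its leading coefficient is
    \<open>k (c x + d) (c y + d)\<close>, which is why the denominators must not vanish.\<close>
  define k' where "k' = c\<^sup>2 * m - c * d * l + d\<^sup>2 * k"
  define l' where "l' = - (2 * a * c * m - (a * d + b * c) * l + 2 * b * d * k)"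
  define m' where "m' = a\<^sup>2 * m - a * b * l + b\<^sup>2 * k"
  define u v where "u = of_int c * x + of_int d" and "v = of_int c * y + of_int d"
  have l: "of_int l = - (of_int k * (x + y))" using s by simp
  have k': "of_int k' = of_int k * u * v"
    unfolding k'_def u_def v_def of_int_add of_int_diff of_int_mult of_int_power l p[symmetric]
    by (simp add: algebra_simps power2_eq_square)
  have l': "of_int l' = - (of_int k * ((of_int a * x + of_int b) * v + (of_int a * y + of_int b) * u))"
    unfolding l'_def u_def v_def of_int_add of_int_diff of_int_mult of_int_minus l p[symmetric]
    by (simp add: algebra_simps)
  have m': "of_int m' = of_int k * ((of_int a * x + of_int b) * (of_int a * y + of_int b))"
    unfolding m'_def of_int_add of_int_diff of_int_mult of_int_power l p[symmetric]
    by (simp add: algebra_simps power2_eq_square)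
  have uv: "u \<noteq> 0" "v \<noteq> 0" using nx ny by (simp_all add: u_def v_def)
  have "real_of_int k' \<noteq> 0" using k uv unfolding k' by simp
  then have 1: "k' \<noteq> 0" by simp
  have 2: "of_int k' * (moebius a b c d x + moebius a b c d y) = - of_int l'"
    using uv unfolding moebius_def u_def[symmetric] v_def[symmetric] k' l'
    by (simp add: field_simps)
  have 3: "of_int k' * (moebius a b c d x * moebius a b c d y) = of_int m'"
    using uv unfolding moebius_def u_def[symmetric] v_def[symmetric] k' m'
    by (simp add: field_simps)
  have "l'\<^sup>2 - 4 * k' * m' = (a * d - b * c)\<^sup>2 * (l\<^sup>2 - 4 * k * m)"
    unfolding k'_def l'_def m'_def by algebra
  also have "(a * d - b * c)\<^sup>2 = 1" using det by (metis one_power2 power2_abs)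
  finally have 4: "l'\<^sup>2 - 4 * k' * m' = D" using D by simp
  show ?thesis unfolding conjugate_pair_def using 1 2 3 4 by blast
qed

text \<open>
  If exactly one root of \<open>f = a X\<^sup>2 + b X + c\<close> lies in the unit interval, then \<open>f 0 = c\<close> and
  \<open>f 1 = a + b + c\<close> have opposite signs. In \<open>D = (b + 2 c)\<^sup>2 - 4 (f 0) (f 1)\<close> both summands
  are then nonnegative, so \<open>D\<close> bounds all the coefficients.
\<close>
lemma finite_separated_unit_interval:
  "finite {x. 0 < x \<and> x < 1 \<and> (\<exists>y. conjugate_pair D x y \<and> (y < 0 \<or> 1 < y))}" (is "finite ?X")
proof -
  let ?B = "{- 6 * \<bar>D\<bar>..6 * \<bar>D\<bar>}"
  let ?R = "\<lambda>a b c. {x::real. poly [:of_int c, of_int b, of_int a:] x = 0}"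
  have "?X \<subseteq> (\<Union>a\<in>?B - {0}. \<Union>b\<in>?B. \<Union>c\<in>?B. ?R a b c)"
  proof
    fix x assume "x \<in> ?X"
    then obtain y a b c where x: "0 < x" "x < 1" and y: "y < 0 \<or> 1 < y" and a: "a \<noteq> 0"
      and s: "of_int a * (x + y) = - of_int b" and p: "of_int a * (x * y) = of_int c"
      and D: "b\<^sup>2 - 4 * a * c = D"
      unfolding conjugate_pair_def by blast
    have b: "of_int b = - (of_int a * (x + y))" using s by simp
    have "of_int (c * (a + b + c)) = (of_int a)\<^sup>2 * ((x * (1 - x)) * (y * (1 - y)))"
      unfolding of_int_mult of_int_add b p[symmetric] by (simp add: algebra_simps power2_eq_square)
    moreover have "x * (1 - x) > 0" using x by simp
    moreover have "y * (1 - y) < 0" using y by (auto simp: mult_less_0_iff)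
    moreover have "(real_of_int a)\<^sup>2 > 0" using a by simp
    ultimately have "real_of_int (c * (a + b + c)) < 0"
      by (simp add: mult_pos_neg)
    then have neg: "c * (a + b + c) < 0" by linarith
    have D': "D = (b + 2 * c)\<^sup>2 - 4 * (c * (a + b + c))"
      unfolding D[symmetric] by (simp add: power2_eq_square algebra_simps)
    have nz: "c \<noteq> 0" "a + b + c \<noteq> 0" using neg by auto
    have le: "\<bar>c * (a + b + c)\<bar> \<le> D" using neg D' by (smt (verit) zero_le_power2)
    have "\<bar>c\<bar> * 1 \<le> \<bar>c\<bar> * \<bar>a + b + c\<bar>" using nz by (intro mult_left_mono) auto
    then have c: "\<bar>c\<bar> \<le> D" using le by (simp add: abs_mult)
    have "1 * \<bar>a + b + c\<bar> \<le> \<bar>c\<bar> * \<bar>a + b + c\<bar>" using nz by (intro mult_right_mono) auto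
    then have abc: "\<bar>a + b + c\<bar> \<le> D" using le by (simp add: abs_mult)
    have "\<bar>k\<bar> \<le> k\<^sup>2" for k :: int
      using mult_left_mono[of 1 "\<bar>k\<bar>" "\<bar>k\<bar>"] by (cases "k = 0") (auto simp: power2_eq_square)
    from this[of "b + 2 * c"] have bc: "\<bar>b + 2 * c\<bar> \<le> D" using neg D' by linarith
    have "a \<in> ?B - {0}" "b \<in> ?B" "c \<in> ?B" using a c abc bc by auto
    moreover have "of_int a * x\<^sup>2 + of_int b * x + of_int c = 0"
      unfolding b p[symmetric] by (simp add: algebra_simps power2_eq_square)
    then have "x \<in> ?R a b c" by (simp add: power2_eq_square algebra_simps)
    ultimately show "x \<in> (\<Union>a\<in>?B - {0}. \<Union>b\<in>?B. \<Union>c\<in>?B. ?R a b c)" by blast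
  qed
  moreover have "finite (?R a b c)" if "a \<in> ?B - {0}" for a b c
    using that by (intro poly_roots_finite) simp
  then have "finite (\<Union>a\<in>?B - {0}. \<Union>b\<in>?B. \<Union>c\<in>?B. ?R a b c)"
    by (intro finite_UN_I) auto
  ultimately show ?thesis by (rule finite_subset)
qed

text \<open>A translation by 1 reduces negative points to points of the unit interval.\<close>
lemma finite_separated_pairs:
  "finite {x \<in> {-1..1} - \<rat>. \<exists>y. y \<notin> \<rat> \<and> conjugate_pair D x y \<and> \<lfloor>x\<rfloor> \<noteq> \<lfloor>y\<rfloor>}" (is "finite ?X")
proof -
  let ?U = "{x. 0 < x \<and> x < 1 \<and> (\<exists>y. conjugate_pair D x y \<and> (y < 0 \<or> 1 < y))}"
  have "?X \<subseteq> ?U \<union> (\<lambda>x. x - 1) ` ?U"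
  proof
    fix x assume "x \<in> ?X"
    then obtain y where x: "x \<notin> \<rat>" "-1 \<le> x" "x \<le> 1" and y: "y \<notin> \<rat>"
      and pair: "conjugate_pair D x y" and fl: "\<lfloor>x\<rfloor> \<noteq> \<lfloor>y\<rfloor>" by auto
    have ne: "x \<noteq> -1" "x \<noteq> 0" "x \<noteq> 1" "y \<noteq> -1" "y \<noteq> 0" "y \<noteq> 1" using x(1) y by auto
    show "x \<in> ?U \<union> (\<lambda>x. x - 1) ` ?U"
    proof (cases "x > 0")
      case True
      then have "\<lfloor>x\<rfloor> = 0" using x ne by (simp add: floor_eq_iff)
      then have "\<not> (0 \<le> y \<and> y < 1)" using fl floor_eq_iff[of y 0] by simp
      then have "y < 0 \<or> 1 < y" using ne(6) by linarith
      moreover have "x < 1" using x(3) ne(3) by simp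
      ultimately have "x \<in> ?U" using True pair by blast
      then show ?thesis by (rule UnI1)
    next
      case False
      then have x0: "-1 < x" "x < 0" using x ne by auto
      then have "\<lfloor>x\<rfloor> = -1" by (simp add: floor_eq_iff)
      then have "\<not> (-1 \<le> y \<and> y < 0)" using fl floor_eq_iff[of y "-1"] by simp
      then have "y + 1 < 0 \<or> 1 < y + 1" using ne(5) by linarith
      moreover have "conjugate_pair D (x + 1) (y + 1)"
        using conjugate_pair_moebius[of 1 1 1 0 D x y] pair by (simp add: moebius_def)
      moreover have "0 < x + 1" "x + 1 < 1" using x0 by auto
      ultimately have "x + 1 \<in> ?U" by blast
      moreover have "x = (x + 1) - 1" by simp
      ultimately have "x \<in> (\<lambda>x. x - 1) ` ?U" by (rule rev_image_eqI)
      then show ?thesis by (rule UnI2)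
    qed
  qed
  then show ?thesis by (rule finite_subset) (simp add: finite_separated_unit_interval)
qed

section \<open>Pure periodicity from an invariant domain for the conjugate\<close>

lemma purely_periodic_of_inj_on_finite:
  fixes T :: "real \<Rightarrow> real"
  assumes fin: "finite X" and inv: "T ` X \<subseteq> X" and inj: "inj_on T X" and x: "x \<in> X"
  shows "purely_periodic T x"
proof -
  have orb: "(T ^^ n) x \<in> X" for n using x inv by (induction n) auto
  have "finite (range (\<lambda>n. (T ^^ n) x))"
    by (rule finite_subset[OF _ fin]) (use orb in auto)
  then have "\<not> inj (\<lambda>n. (T ^^ n) x)"
    using finite_imageD infinite_UNIV_nat by blast
  then obtain m n where mn: "m < n" "(T ^^ m) x = (T ^^ n) x"
    unfolding inj_def by (metis linorder_neqE_nat)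
  have cancel: "(T ^^ m) x = (T ^^ (m + k)) x \<Longrightarrow> x = (T ^^ k) x" for m k
  proof (induction m)
    case (Suc m)
    then have "T ((T ^^ m) x) = T ((T ^^ (m + k)) x)" by simp
    then have "(T ^^ m) x = (T ^^ (m + k)) x" by (rule inj_onD[OF inj _ orb orb])
    then show ?case by (rule Suc.IH)
  qed simp
  have "x = (T ^^ (n - m)) x" using cancel[of m "n - m"] mn by simp
  then show ?thesis unfolding purely_periodic_def using mn(1)
    by (intro exI[of _ "n - m"]) simp
qed

text \<open>
  The set of pairs \<open>(x, y)\<close> with \<open>y \<in> fibre x\<close> is the domain of a natural extension of \<open>T\<close>.
  Injectivity of the natural extension is demanded for conjugate pairs only: for the Odd and
  Nearest Integer maps, images of different fibres overlap in boundary points, and it takes the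
  conjugacy of \<open>x\<close> and \<open>y\<close> to see that the overlap is harmless. The seed is a translate of \<open>x\<close>
  by an integer, which makes it irrational and different from \<open>x\<close>.
\<close>
locale moebius_expansion =
  fixes T :: "real \<Rightarrow> real" and dom :: "real set" and fibre :: "real \<Rightarrow> real set"
    and a b c d :: "real \<Rightarrow> int"
  assumes dom_bounded: "dom \<subseteq> {-1..1}"
    and det: "x \<in> dom \<Longrightarrow> x \<notin> \<rat> \<Longrightarrow> \<bar>a x * d x - b x * c x\<bar> = 1"
    and T_eq: "x \<in> dom \<Longrightarrow> x \<notin> \<rat> \<Longrightarrow> T x = moebius (a x) (b x) (c x) (d x) x"
    and T_dom: "x \<in> dom \<Longrightarrow> x \<notin> \<rat> \<Longrightarrow> T x \<in> dom"
    and expanding: "x \<in> dom \<Longrightarrow> x \<notin> \<rat> \<Longrightarrow> \<bar>of_int (c x) * x + of_int (d x)\<bar> < 1"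
    and fibre_invariant: "x \<in> dom \<Longrightarrow> x \<notin> \<rat> \<Longrightarrow> y \<in> fibre x \<Longrightarrow> y \<notin> \<rat> \<Longrightarrow>
       moebius (a x) (b x) (c x) (d x) y \<in> fibre (T x)"
    and fibre_closed: "closed (fibre x)"
    and fibre_seed: "x \<in> dom \<Longrightarrow> x \<notin> \<rat> \<Longrightarrow> \<exists>n::int. n \<noteq> 0 \<and> x + of_int n \<in> fibre x"
    and fibre_separated: "x \<in> dom \<Longrightarrow> x \<notin> \<rat> \<Longrightarrow> y \<in> fibre x \<Longrightarrow> y \<notin> \<rat> \<Longrightarrow> \<lfloor>x\<rfloor> \<noteq> \<lfloor>y\<rfloor>"
    and injective: "x \<in> dom \<Longrightarrow> quadratic_irrational x \<Longrightarrow> galois_conjugate x \<in> fibre x \<Longrightarrow>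
       x' \<in> dom \<Longrightarrow> quadratic_irrational x' \<Longrightarrow> galois_conjugate x' \<in> fibre x' \<Longrightarrow>
       T x = T x' \<Longrightarrow> moebius (a x) (b x) (c x) (d x) (galois_conjugate x) =
         moebius (a x') (b x') (c x') (d x') (galois_conjugate x') \<Longrightarrow> x = x'"
begin

definition branch :: "real \<Rightarrow> real \<Rightarrow> real" where
  "branch x = moebius (a x) (b x) (c x) (d x)"

definition denom :: "real \<Rightarrow> real \<Rightarrow> real" where
  "denom x z = \<bar>of_int (c x) * z + of_int (d x)\<bar>"

lemma T_irrational: "x \<in> dom \<Longrightarrow> x \<notin> \<rat> \<Longrightarrow> T x \<notin> \<rat>"
  by (simp add: T_eq det moebius_irrational)

lemma denom_pos: "x \<in> dom \<Longrightarrow> x \<notin> \<rat> \<Longrightarrow> z \<notin> \<rat> \<Longrightarrow> denom x z > 0"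
  unfolding denom_def using moebius_denominator_nonzero[OF det] by simp

lemma branch_diff:
  assumes "x \<in> dom" "x \<notin> \<rat>" "z \<notin> \<rat>" "w \<notin> \<rat>"
  shows "\<bar>branch x z - branch x w\<bar> * (denom x z * denom x w) = \<bar>z - w\<bar>"
  unfolding branch_def denom_def using assms
  by (intro moebius_diff det moebius_denominator_nonzero[OF det])

lemma conjugate_pair_T:
  assumes "x \<in> dom" "quadratic_irrational x" "conjugate_pair D x (galois_conjugate x)"
  shows "conjugate_pair D (T x) (branch x (galois_conjugate x))"
proof -
  have x: "x \<notin> \<rat>" using assms by (simp add: quadratic_irrational_def)
  show ?thesis unfolding T_eq[OF assms(1) x] branch_def
    using assms x galois_conjugate_irrational[OF assms(2)]
    by (intro conjugate_pair_moebius det moebius_denominator_nonzero[OF det])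
qed

lemma galois_conjugate_T:
  assumes "x \<in> dom" "quadratic_irrational x"
  shows "quadratic_irrational (T x)" "galois_conjugate (T x) = branch x (galois_conjugate x)"
proof -
  have x: "x \<notin> \<rat>" using assms by (simp add: quadratic_irrational_def)
  obtain D where "conjugate_pair D x (galois_conjugate x)"
    using conjugate_pair_exists[OF assms(2)] .
  note pair = conjugate_pair_T[OF assms this] T_irrational[OF assms(1) x]
  show "quadratic_irrational (T x)" "galois_conjugate (T x) = branch x (galois_conjugate x)"
    using conjugate_pair_galois[OF pair] by auto
qed

text \<open>
  The orbit stays in a finite set, by the finiteness of separated conjugate pairs with the
  discriminant of \<open>\<omega>\<close>, and \<open>T\<close> permutes that set.
\<close>
lemma periodic_if_conjugate_in_fibre:
  assumes \<omega>: "\<omega> \<in> dom" "quadratic_irrational \<omega>" and mem: "galois_conjugate \<omega> \<in> fibre \<omega>"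
  shows "purely_periodic T \<omega>"
proof -
  obtain D where D: "conjugate_pair D \<omega> (galois_conjugate \<omega>)"
    using conjugate_pair_exists[OF \<omega>(2)] .
  define X where "X = {x \<in> dom. quadratic_irrational x \<and> galois_conjugate x \<in> fibre x \<and>
    conjugate_pair D x (galois_conjugate x)}"
  have irr: "x \<notin> \<rat>" if "quadratic_irrational x" for x
    using that by (simp add: quadratic_irrational_def)
  show ?thesis
  proof (rule purely_periodic_of_inj_on_finite[of X])
    have "X \<subseteq> {x \<in> {-1..1} - \<rat>. \<exists>y. y \<notin> \<rat> \<and> conjugate_pair D x y \<and> \<lfloor>x\<rfloor> \<noteq> \<lfloor>y\<rfloor>}"
    proof
      fix x assume "x \<in> X"
      then have x: "x \<in> dom" "quadratic_irrational x" "galois_conjugate x \<in> fibre x"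
        "conjugate_pair D x (galois_conjugate x)" by (auto simp: X_def)
      note y = galois_conjugate_irrational(1)[OF x(2)]
      have "\<lfloor>x\<rfloor> \<noteq> \<lfloor>galois_conjugate x\<rfloor>"
        using fibre_separated[OF x(1) irr[OF x(2)] x(3) y] .
      then show "x \<in> {x \<in> {-1..1} - \<rat>. \<exists>y. y \<notin> \<rat> \<and> conjugate_pair D x y \<and> \<lfloor>x\<rfloor> \<noteq> \<lfloor>y\<rfloor>}"
        using x y irr[OF x(2)] dom_bounded by blast
    qed
    then show "finite X" using finite_separated_pairs by (rule finite_subset)
    show "T ` X \<subseteq> X"
    proof
      fix x' assume "x' \<in> T ` X"
      then obtain x where x': "x' = T x" and x: "x \<in> dom" "quadratic_irrational x"
        "galois_conjugate x \<in> fibre x" "conjugate_pair D x (galois_conjugate x)"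
        by (auto simp: X_def)
      show "x' \<in> X" unfolding X_def x'
        using galois_conjugate_T[OF x(1,2)] T_dom[OF x(1) irr[OF x(2)]] conjugate_pair_T[OF x(1,2,4)]
          fibre_invariant[OF x(1) irr[OF x(2)] x(3) galois_conjugate_irrational(1)[OF x(2)]]
        by (simp add: branch_def)
    qed
    show "inj_on T X"
    proof (rule inj_onI)
      fix x x' assume "x \<in> X" "x' \<in> X" and eq: "T x = T x'"
      then have x: "x \<in> dom" "quadratic_irrational x" "galois_conjugate x \<in> fibre x"
        and x': "x' \<in> dom" "quadratic_irrational x'" "galois_conjugate x' \<in> fibre x'"
        by (auto simp: X_def)
      have "branch x (galois_conjugate x) = branch x' (galois_conjugate x')"
        using eq galois_conjugate_T(2)[OF x(1,2)] galois_conjugate_T(2)[OF x'(1,2)] by simp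
      then show "x = x'" using injective[OF x x' eq] by (simp add: branch_def)
    qed
    show "\<omega> \<in> X" using \<omega> mem D by (simp add: X_def)
  qed
qed

text \<open>
  The action on the second coordinate: \<open>z\<close> is moved by the transformations which \<open>T\<close> selects
  along the orbit of \<open>x\<close>.
\<close>
primrec transport :: "real \<Rightarrow> nat \<Rightarrow> real \<Rightarrow> real" where
  "transport x 0 z = z"
| "transport x (Suc n) z = branch ((T ^^ n) x) (transport x n z)"

text \<open>
  Absolute value of the denominator, at \<open>z\<close>, of the composition of the first \<open>n\<close> transformations;
  up to sign, its inverse square is the derivative at \<open>z\<close>.
\<close>
definition cocycle :: "real \<Rightarrow> nat \<Rightarrow> real \<Rightarrow> real" where
  "cocycle x n z = (\<Prod>i<n. denom ((T ^^ i) x) (transport x i z))"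

lemma orbit_dom:
  assumes "x \<in> dom" "x \<notin> \<rat>"
  shows "(T ^^ n) x \<in> dom" "(T ^^ n) x \<notin> \<rat>"
  using assms by (induction n) (auto simp: T_dom T_irrational)

lemma transport_irrational:
  assumes "x \<in> dom" "x \<notin> \<rat>" "z \<notin> \<rat>"
  shows "transport x n z \<notin> \<rat>"
  using assms orbit_dom[OF assms(1,2)]
  by (induction n) (auto simp: branch_def det moebius_irrational)

lemma transport_self:
  assumes "x \<in> dom" "x \<notin> \<rat>"
  shows "transport x n x = (T ^^ n) x"
  by (induction n) (simp_all add: branch_def T_eq orbit_dom[OF assms])

lemma transport_conjugate:
  assumes "x \<in> dom" "quadratic_irrational x"
  shows "transport x n (galois_conjugate x) = galois_conjugate ((T ^^ n) x) \<and>
    quadratic_irrational ((T ^^ n) x)"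
proof (induction n)
  case (Suc n)
  have "(T ^^ n) x \<in> dom" using assms orbit_dom by (simp add: quadratic_irrational_def)
  then show ?case using Suc galois_conjugate_T by simp
qed (use assms in simp)

lemma transport_fibre:
  assumes "x \<in> dom" "x \<notin> \<rat>" "z \<notin> \<rat>" "z \<in> fibre x"
  shows "transport x n z \<in> fibre ((T ^^ n) x)"
proof (induction n)
  case (Suc n)
  then show ?case
    using fibre_invariant orbit_dom[OF assms(1,2)] transport_irrational[OF assms(1-3)]
    by (simp add: branch_def)
qed (use assms in simp)

lemma cocycle_pos:
  assumes "x \<in> dom" "x \<notin> \<rat>" "z \<notin> \<rat>"
  shows "cocycle x n z > 0"
  unfolding cocycle_def
  by (intro prod_pos ballI denom_pos orbit_dom transport_irrational assms)

lemma cocycle_self_less_1: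
  assumes "x \<in> dom" "x \<notin> \<rat>"
  shows "cocycle x (Suc n) x < 1"
proof (induction n)
  have lt: "denom ((T ^^ n) x) (transport x n x) < 1" for n
    unfolding transport_self[OF assms] denom_def by (rule expanding[OF orbit_dom[OF assms]])
  {
    case 0
    show ?case using lt[of 0] by (simp add: cocycle_def)
  next
    case (Suc n)
    have "cocycle x (Suc (Suc n)) x =
        cocycle x (Suc n) x * denom ((T ^^ Suc n) x) (transport x (Suc n) x)"
      unfolding cocycle_def by (rule prod.lessThan_Suc)
    also have "\<dots> < 1 * 1"
      using Suc lt[of "Suc n"] cocycle_pos[OF assms assms(2), of "Suc n"]
        denom_pos[OF orbit_dom[OF assms] transport_irrational[OF assms assms(2)], of "Suc n" "Suc n"]
      by (intro mult_strict_mono) (auto simp del: funpow.simps transport.simps)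
    finally show ?case by simp
  }
qed

lemma transport_diff:
  assumes "x \<in> dom" "x \<notin> \<rat>" "z \<notin> \<rat>" "w \<notin> \<rat>"
  shows "\<bar>transport x n z - transport x n w\<bar> * (cocycle x n z * cocycle x n w) = \<bar>z - w\<bar>"
proof (induction n)
  case (Suc n)
  let ?z = "transport x n z" and ?w = "transport x n w" and ?x = "(T ^^ n) x"
  have "\<bar>branch ?x ?z - branch ?x ?w\<bar> * (denom ?x ?z * denom ?x ?w) = \<bar>?z - ?w\<bar>"
    using assms by (intro branch_diff orbit_dom transport_irrational)
  then show ?case unfolding Suc[symmetric]
    by (simp add: cocycle_def mult_ac)
qed (simp add: cocycle_def)

text \<open>
  Write \<open>\<kappa> < 1\<close> for the cocycle of \<open>\<omega>\<close> over one period. Since \<open>\<omega>\<close> and its conjugate \<open>y\<close> both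
  return, the distance formula forces the cocycle of \<open>y\<close> to be \<open>1 / \<kappa>\<close>. Comparing the distances
  of a third point \<open>z\<close> to \<open>y\<close> and to \<open>\<omega>\<close> eliminates the cocycle of \<open>z\<close>: the quotient
  \<open>\<bar>z - y\<bar> / \<bar>z - \<omega>\<bar>\<close> is multiplied by \<open>\<kappa>\<^sup>2\<close> in every period. If \<open>y\<close> had a positive
  distance to the fibre, this quotient would be bounded away from 0 on the fibre.
\<close>
lemma conjugate_in_fibre_if_periodic:
  assumes \<omega>: "\<omega> \<in> dom" "quadratic_irrational \<omega>" and per: "purely_periodic T \<omega>"
  shows "galois_conjugate \<omega> \<in> fibre \<omega>"
proof (rule ccontr)
  assume notin: "galois_conjugate \<omega> \<notin> fibre \<omega>"
  define y where "y = galois_conjugate \<omega>"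
  have irr: "\<omega> \<notin> \<rat>" using \<omega> by (simp add: quadratic_irrational_def)
  have y: "y \<notin> \<rat>" "y \<noteq> \<omega>" using galois_conjugate_irrational[OF \<omega>(2)] by (auto simp: y_def)
  obtain p where p: "p \<ge> 1" "(T ^^ p) \<omega> = \<omega>" using per unfolding purely_periodic_def by blast
  define J where "J = cocycle \<omega> p"
  define \<kappa> where "\<kappa> = J \<omega>"
  have \<kappa>: "0 < \<kappa>" "\<kappa> < 1"
    using cocycle_pos[OF \<omega>(1) irr irr, of p] cocycle_self_less_1[OF \<omega>(1) irr, of "p - 1"] p(1)
    by (auto simp: \<kappa>_def J_def)
  have fix_\<omega>: "transport \<omega> p \<omega> = \<omega>" using transport_self[OF \<omega>(1) irr] p by simp
  have fix_y: "transport \<omega> p y = y" using transport_conjugate[OF \<omega>, of p] p by (simp add: y_def)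
  have Jpos: "J z > 0" if "z \<notin> \<rat>" for z
    unfolding J_def by (rule cocycle_pos[OF \<omega>(1) irr that])
  have "\<kappa> * J y = 1"
    using transport_diff[OF \<omega>(1) irr irr y(1), of p] y(2)
    unfolding fix_\<omega> fix_y \<kappa>_def J_def by simp
  then have Jy: "J y = 1 / \<kappa>" using \<kappa> by (simp add: field_simps)
  obtain m :: int where m: "m \<noteq> 0" "\<omega> + of_int m \<in> fibre \<omega>" using fibre_seed[OF \<omega>(1) irr] by blast
  define z0 where "z0 = \<omega> + of_int m"
  have "z0 \<notin> \<rat>"
  proof
    assume "z0 \<in> \<rat>"
    then have "z0 - of_int m \<in> \<rat>" by (intro Rats_diff) auto
    with irr show False by (simp add: z0_def)
  qed
  then have z0: "z0 \<in> fibre \<omega>" "z0 \<notin> \<rat>" "z0 \<noteq> \<omega>" using m by (auto simp: z0_def)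
  \<comment> \<open>Transport over one period.\<close>
  have step: "\<exists>z'. z' \<in> fibre \<omega> \<and> z' \<notin> \<rat> \<and> z' \<noteq> \<omega> \<and>
      \<bar>z' - y\<bar> / \<bar>z' - \<omega>\<bar> = \<kappa>\<^sup>2 * (\<bar>z - y\<bar> / \<bar>z - \<omega>\<bar>)"
    if z: "z \<in> fibre \<omega>" "z \<notin> \<rat>" "z \<noteq> \<omega>" for z
  proof -
    define z' where "z' = transport \<omega> p z"
    have "z' \<in> fibre \<omega>" unfolding z'_def using transport_fibre[OF \<omega>(1) irr z(2,1), of p] p by simp
    moreover have "z' \<notin> \<rat>" unfolding z'_def by (rule transport_irrational[OF \<omega>(1) irr z(2)])
    moreover have e1: "\<bar>z' - y\<bar> * (J z * (1 / \<kappa>)) = \<bar>z - y\<bar>"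
      using transport_diff[OF \<omega>(1) irr z(2) y(1), of p]
      unfolding fix_y J_def[symmetric] Jy z'_def[symmetric] .
    have e2: "\<bar>z' - \<omega>\<bar> * (J z * \<kappa>) = \<bar>z - \<omega>\<bar>"
      using transport_diff[OF \<omega>(1) irr z(2) irr, of p]
      unfolding fix_\<omega> J_def[symmetric] \<kappa>_def[symmetric] z'_def[symmetric] .
    have "z' \<noteq> \<omega>" using e2 z(3) by auto
    moreover have "\<bar>z' - y\<bar> / \<bar>z' - \<omega>\<bar> = \<kappa>\<^sup>2 * (\<bar>z - y\<bar> / \<bar>z - \<omega>\<bar>)"
      unfolding e1[symmetric] e2[symmetric] using \<kappa> Jpos[OF z(2)] \<open>z' \<noteq> \<omega>\<close>
      by (simp add: field_simps power2_eq_square)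
    ultimately show ?thesis by blast
  qed
  define r0 where "r0 = \<bar>z0 - y\<bar> / \<bar>z0 - \<omega>\<bar>"
  have iter: "\<exists>z. z \<in> fibre \<omega> \<and> z \<notin> \<rat> \<and> z \<noteq> \<omega> \<and> \<bar>z - y\<bar> / \<bar>z - \<omega>\<bar> = (\<kappa>\<^sup>2) ^ k * r0" for k
  proof (induction k)
    case 0
    then show ?case using z0 by (auto simp: r0_def)
  next
    case (Suc k)
    then obtain z where z: "z \<in> fibre \<omega>" "z \<notin> \<rat>" "z \<noteq> \<omega>" and
      r: "\<bar>z - y\<bar> / \<bar>z - \<omega>\<bar> = (\<kappa>\<^sup>2) ^ k * r0" by blast
    from step[OF z] show ?case unfolding r by (simp add: mult.assoc)
  qed
  have "open (- fibre \<omega>)" using fibre_closed by (simp add: open_Compl)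
  then obtain e where e: "e > 0" and far: "\<And>z. z \<in> fibre \<omega> \<Longrightarrow> \<bar>z - y\<bar> \<ge> e"
    using notin unfolding open_dist y_def[symmetric] dist_real_def
    by (metis ComplD ComplI linorder_not_less)
  \<comment> \<open>Lower bound of \<open>t / (t + \<bar>y - \<omega>\<bar>)\<close> for \<open>t \<ge> e\<close>.\<close>
  define q where "q = e / (e + \<bar>y - \<omega>\<bar>)"
  have q: "q > 0" using e by (simp add: q_def add_pos_nonneg)
  have low: "q \<le> \<bar>z - y\<bar> / \<bar>z - \<omega>\<bar>" if "z \<in> fibre \<omega>" "z \<noteq> \<omega>" for z
  proof -
    have "e * \<bar>z - \<omega>\<bar> \<le> e * (\<bar>z - y\<bar> + \<bar>y - \<omega>\<bar>)" using e by (intro mult_left_mono) auto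
    also have "\<dots> \<le> \<bar>z - y\<bar> * (e + \<bar>y - \<omega>\<bar>)"
      using mult_right_mono[OF far[OF that(1)], of "\<bar>y - \<omega>\<bar>"] by (simp add: algebra_simps)
    finally show ?thesis using e that(2) unfolding q_def
      by (simp add: divide_le_eq le_divide_eq add_pos_nonneg field_simps)
  qed
  have "\<kappa>\<^sup>2 < 1" using \<kappa> by (simp add: abs_square_less_1)
  then have "(\<lambda>k. (\<kappa>\<^sup>2) ^ k * r0) \<longlonglongrightarrow> 0 * r0"
    by (intro tendsto_mult LIMSEQ_power_zero tendsto_const) simp
  then have "\<forall>\<^sub>F k in sequentially. (\<kappa>\<^sup>2) ^ k * r0 < q"
    using q by (intro order_tendstoD(2)[where y = 0]) auto
  then obtain k where "(\<kappa>\<^sup>2) ^ k * r0 < q" using eventually_happens by force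
  with iter[of k] low show False by (metis linorder_not_less)
qed

theorem purely_periodic_iff:
  assumes "\<omega> \<in> dom" "quadratic_irrational \<omega>"
  shows "purely_periodic T \<omega> \<longleftrightarrow> galois_conjugate \<omega> \<in> fibre \<omega>"
  using assms periodic_if_conjugate_in_fibre conjugate_in_fibre_if_periodic by blast

end

section \<open>Folded continued fractions\<close>

lemma inverse_irrational:
  fixes x :: real
  assumes "x \<notin> \<rat>"
  shows "\<bar>inverse x\<bar> \<notin> \<rat>"
proof
  assume "\<bar>inverse x\<bar> \<in> \<rat>"
  then have "inverse \<bar>inverse x\<bar> \<in> \<rat>" by (rule Rats_inverse)
  then have "x \<in> \<rat>" by (auto simp: abs_if split: if_splits)
  with assms show False by simp
qed

text \<open>
  Maps \<open>x \<mapsto> \<bar>1/x\<bar> - N x\<close> with fibre \<open>{..-\<beta>}\<close> over negative and \<open>{..-\<gamma>}\<close> over positive points.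
  The digit conditions are the ones explained at the beginning. As the digit gap may be equal to
  the length of \<open>{-1/\<gamma>..1/\<beta>}\<close>, injectivity can only fail for a conjugate at the end \<open>-1/\<gamma>\<close>, that
  is, for a positive point with conjugate \<open>-\<gamma>\<close>; the last assumption excludes such points.
\<close>
locale folded_expansion =
  fixes N :: "real \<Rightarrow> int" and r \<beta> \<gamma> :: real
  assumes r: "0 < r" "r \<le> 1" and \<beta>: "1 \<le> \<beta>" and \<gamma>: "0 < \<gamma>"
    and remainder: "x \<in> {-r..r} \<Longrightarrow> x \<notin> \<rat> \<Longrightarrow> \<bar>\<bar>inverse x\<bar> - of_int (N x)\<bar> \<le> r"
    and digit_neg: "x \<in> {-r..r} \<Longrightarrow> x \<notin> \<rat> \<Longrightarrow> \<bar>inverse x\<bar> < of_int (N x) \<Longrightarrow>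
      \<beta> + 1 / \<beta> \<le> of_int (N x)"
    and digit_pos: "x \<in> {-r..r} \<Longrightarrow> x \<notin> \<rat> \<Longrightarrow> \<bar>inverse x\<bar> > of_int (N x) \<Longrightarrow>
      \<gamma> + 1 / \<beta> \<le> of_int (N x)"
    and digit_gap: "x \<in> {-r..r} \<Longrightarrow> x \<notin> \<rat> \<Longrightarrow> x' \<in> {-r..r} \<Longrightarrow> x' \<notin> \<rat> \<Longrightarrow>
      N x < N x' \<Longrightarrow> 1 / \<beta> + 1 / \<gamma> \<le> of_int (N x') - of_int (N x)"
    and conjugate_boundary: "x \<in> {-r..r} \<Longrightarrow> quadratic_irrational x \<Longrightarrow> x > 0 \<Longrightarrow>
      galois_conjugate x \<noteq> - \<gamma>"
begin

definition threshold :: "real \<Rightarrow> real" where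
  "threshold x = (if x < 0 then \<beta> else \<gamma>)"

definition eps :: "real \<Rightarrow> int" where
  "eps x = (if x < 0 then -1 else 1)"

lemma branch_eq: "y \<noteq> 0 \<Longrightarrow> moebius (- N x) (eps x) 1 0 y = of_int (eps x) / y - of_int (N x)"
  by (simp add: moebius_def field_simps)

lemma branch_range:
  assumes "x \<noteq> 0" "y \<le> - threshold x"
  shows "- (1 / \<gamma>) \<le> of_int (eps x) / y" "of_int (eps x) / y \<le> 1 / \<beta>" "y < 0"
proof -
  have bound: "- (1 / \<delta>) \<le> 1 / y" if "0 < \<delta>" "y \<le> - \<delta>" for \<delta>
    using that by (simp add: field_simps)
  have \<beta>0: "0 < \<beta>" using \<beta> by simp
  show y: "y < 0" using assms \<beta>0 \<gamma> by (auto simp: threshold_def split: if_splits)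
  then have sgn: "1 / y < 0" "0 < 1 / \<gamma>" "0 < 1 / \<beta>" using \<gamma> \<beta>0 by (auto simp: divide_less_0_iff)
  show "- (1 / \<gamma>) \<le> of_int (eps x) / y"
  proof (cases "x < 0")
    case True
    then have "of_int (eps x) / y = - (1 / y)" by (simp add: eps_def)
    with sgn show ?thesis by linarith
  next
    case False
    then have "of_int (eps x) / y = 1 / y" "y \<le> - \<gamma>"
      using assms(2) by (simp_all add: eps_def threshold_def)
    with bound[OF \<gamma>] show ?thesis by linarith
  qed
  show "of_int (eps x) / y \<le> 1 / \<beta>"
  proof (cases "x < 0")
    case True
    then have "of_int (eps x) / y = - (1 / y)" "y \<le> - \<beta>"
      using assms(2) by (simp_all add: eps_def threshold_def)
    with bound[OF \<beta>0] show ?thesis by linarith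
  next
    case False
    then have "of_int (eps x) / y = 1 / y" by (simp add: eps_def)
    with sgn show ?thesis by linarith
  qed
qed

text \<open>
  The digit is determined by the image of the conjugate: two different digits would force
  the images before subtraction of the digit to be the two end points of \<open>{-1/\<gamma>..1/\<beta>}\<close>, and the
  end point \<open>-1/\<gamma>\<close> is excluded.
\<close>
lemma same_digit:
  assumes x: "x \<in> {-r..r}" "quadratic_irrational x" "galois_conjugate x \<le> - threshold x"
    and x': "x' \<in> {-r..r}" "quadratic_irrational x'" "galois_conjugate x' \<le> - threshold x'"
    and eq: "of_int (eps x) / galois_conjugate x - of_int (N x) =
      of_int (eps x') / galois_conjugate x' - of_int (N x')"
  shows "\<not> N x < N x'"
proof
  assume less: "N x < N x'"
  have irr: "x \<notin> \<rat>" "x' \<notin> \<rat>" using x(2) x'(2) by (auto simp: quadratic_irrational_def)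
  then have nz: "x \<noteq> 0" "x' \<noteq> 0" by auto
  define y where "y = galois_conjugate x"
  have gap: "1 / \<beta> + 1 / \<gamma> \<le> of_int (N x') - of_int (N x)"
    by (rule digit_gap[OF x(1) irr(1) x'(1) irr(2) less])
  have "- (1 / \<gamma>) \<le> of_int (eps x) / y" using branch_range(1)[OF nz(1) x(3)] by (simp add: y_def)
  moreover have "of_int (eps x') / galois_conjugate x' \<le> 1 / \<beta>"
    using branch_range(2)[OF nz(2) x'(3)] .
  ultimately have bd: "of_int (eps x) / y = - (1 / \<gamma>)"
    using gap eq unfolding y_def by linarith
  have y: "y < 0" using branch_range(3)[OF nz(1) x(3)] by (simp add: y_def)
  have "1 / \<gamma> > 0" using \<gamma> by simp
  then have "of_int (eps x) / y < 0" using bd by linarith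
  then have "x > 0" "eps x = 1" using y nz by (auto simp: eps_def divide_less_0_iff split: if_splits)
  then have "y = - \<gamma>" using bd y \<gamma> by (simp add: field_simps)
  with conjugate_boundary[OF x(1,2) \<open>x > 0\<close>] show False by (simp add: y_def)
qed

sublocale moebius_expansion "\<lambda>x. \<bar>inverse x\<bar> - of_int (N x)" "{-r..r}"
  "\<lambda>x. {..- threshold x}" "\<lambda>x. - N x" eps "\<lambda>_. 1" "\<lambda>_. 0"
proof
  show "{-r..r} \<subseteq> {-1..1}" using r by auto
  show "\<bar>- N x * 0 - eps x * 1\<bar> = 1" for x by (simp add: eps_def)
  show "closed {..- threshold x}" for x by simp
next
  fix x :: real assume x: "x \<in> {-r..r}" "x \<notin> \<rat>"
  then have nz: "x \<noteq> 0" by auto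
  have x1: "x \<noteq> 1" "x \<noteq> -1" using x(2) by auto
  show "\<bar>inverse x\<bar> - of_int (N x) = moebius (- N x) (eps x) 1 0 x"
    unfolding branch_eq[OF nz] by (simp add: eps_def abs_if inverse_eq_divide)
  show "\<bar>inverse x\<bar> - of_int (N x) \<in> {-r..r}"
    using remainder[OF x] by auto
  show "\<bar>of_int 1 * x + of_int 0\<bar> < 1" using x r x1 by auto
  show "\<exists>n. n \<noteq> 0 \<and> x + real_of_int n \<in> {..- threshold x}"
  proof (intro exI conjI)
    let ?n = "- 1 - \<lceil>\<bar>threshold x\<bar>\<rceil>"
    show "?n \<noteq> 0" by (smt (verit) zero_le_ceiling abs_ge_zero)
    show "x + real_of_int ?n \<in> {..- threshold x}"
    proof -
      have "x \<le> 1" using x r by simp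
      then show ?thesis using le_of_int_ceiling[of "\<bar>threshold x\<bar>"] by simp linarith
    qed
  qed
  fix y :: real assume y: "y \<in> {..- threshold x}" "y \<notin> \<rat>"
  have y': "y \<le> - threshold x" using y by simp
  note range = branch_range[OF nz y']
  have "\<bar>inverse x\<bar> \<noteq> of_int (N x)"
    using inverse_irrational[OF x(2)] by (metis Rats_of_int)
  then have "of_int (eps x) / y - of_int (N x) \<le> - threshold (\<bar>inverse x\<bar> - of_int (N x))"
    using range(2) digit_neg[OF x] digit_pos[OF x] by (auto simp: threshold_def)
  then show "moebius (- N x) (eps x) 1 0 y \<in> {..- threshold (\<bar>inverse x\<bar> - of_int (N x))}"
    using range(3) by (simp add: branch_eq)
  show "\<lfloor>x\<rfloor> \<noteq> \<lfloor>y\<rfloor>"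
  proof (cases "x < 0")
    case True
    then have "\<lfloor>x\<rfloor> = -1" using x r x1 by (simp add: floor_eq_iff)
    moreover have "y < -1" using True y y' \<beta> by (cases "y = -1") (auto simp: threshold_def)
    then have "\<lfloor>y\<rfloor> < -1" by (simp add: floor_less_iff)
    ultimately show ?thesis by linarith
  next
    case False
    then have "\<lfloor>x\<rfloor> \<ge> 0" by simp
    moreover have "\<lfloor>y\<rfloor> < 0" using range(3) by (simp add: floor_less_iff)
    ultimately show ?thesis by linarith
  qed
next
  fix x x' :: real
  assume x: "x \<in> {-r..r}" "quadratic_irrational x" "galois_conjugate x \<in> {..- threshold x}"
    and x': "x' \<in> {-r..r}" "quadratic_irrational x'" "galois_conjugate x' \<in> {..- threshold x'}"
    and T: "\<bar>inverse x\<bar> - real_of_int (N x) = \<bar>inverse x'\<bar> - real_of_int (N x')"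
    and br: "moebius (- N x) (eps x) 1 0 (galois_conjugate x) =
      moebius (- N x') (eps x') 1 0 (galois_conjugate x')"
  have irr: "x \<notin> \<rat>" "x' \<notin> \<rat>" using x(2) x'(2) by (auto simp: quadratic_irrational_def)
  then have nz: "x \<noteq> 0" "x' \<noteq> 0" by auto
  define y y' where "y = galois_conjugate x" and "y' = galois_conjugate x'"
  have le: "y \<le> - threshold x" "y' \<le> - threshold x'" using x(3) x'(3) by (auto simp: y_def y'_def)
  have neg: "y < 0" "y' < 0"
    using branch_range(3)[OF nz(1) le(1)] branch_range(3)[OF nz(2) le(2)] by auto
  have eq: "of_int (eps x) / y - of_int (N x) = of_int (eps x') / y' - of_int (N x')"
    using br neg by (simp add: branch_eq y_def y'_def)
  have "\<not> N x < N x'"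
    by (rule same_digit[OF x(1,2) le(1)[unfolded y_def] x'(1,2) le(2)[unfolded y'_def]])
      (rule eq[unfolded y_def y'_def])
  moreover have "\<not> N x' < N x"
    by (rule same_digit[OF x'(1,2) le(2)[unfolded y'_def] x(1,2) le(1)[unfolded y_def]])
      (rule eq[symmetric, unfolded y_def y'_def])
  ultimately have N: "N x = N x'" by linarith
  then have quot: "of_int (eps x) / y = of_int (eps x') / y'" using eq by simp
  have "1 / y < 0" "1 / y' < 0" using neg by (auto simp: divide_less_0_iff)
  then have same_sign: "x < 0 \<longleftrightarrow> x' < 0"
    using quot by (cases "x < 0"; cases "x' < 0"; simp add: eps_def)
  have "\<bar>inverse x\<bar> = \<bar>inverse x'\<bar>" using T N by simp
  then have "\<bar>x\<bar> = \<bar>x'\<bar>" by simp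
  then show "x = x'" using same_sign by linarith
qed

lemma periodic_iff_threshold:
  assumes "x \<in> {-r..r}" "quadratic_irrational x"
  shows "purely_periodic (\<lambda>x. \<bar>inverse x\<bar> - of_int (N x)) x \<longleftrightarrow>
    x < 0 \<and> galois_conjugate x \<le> - \<beta> \<or> x > 0 \<and> galois_conjugate x \<le> - \<gamma>"
proof -
  have "x \<noteq> 0" using assms by (auto simp: quadratic_irrational_def)
  then show ?thesis using purely_periodic_iff[OF assms] by (auto simp: threshold_def)
qed

end

lemma tau_square: "tau\<^sup>2 = tau + 1"
  by (simp add: tau_def power2_eq_square field_simps)

lemma tau_bounds: "3/2 < tau" "tau < 2"
proof -
  have "sqrt 5 > 2" by (rule real_less_rsqrt) simp
  moreover have "sqrt 5 < 3" by (rule real_less_lsqrt) auto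
  ultimately show "3/2 < tau" "tau < 2" by (auto simp: tau_def)
qed

lemma tau_inverses: "1 / (tau - 1) = tau" "1 / tau = tau - 1" "1 / (tau + 1) = 2 - tau"
proof -
  have sq: "tau * tau = tau + 1" using tau_square by (simp add: power2_eq_square)
  show "1 / (tau - 1) = tau" using tau_bounds sq by (simp add: divide_eq_eq algebra_simps)
  show "1 / tau = tau - 1" using tau_bounds sq by (subst divide_eq_eq) (simp add: algebra_simps)
  show "1 / (tau + 1) = 2 - tau" using tau_bounds sq by (subst divide_eq_eq) (simp add: algebra_simps)
qed

text \<open>
  Conjugation is an involution; in this form it recovers a point from a conjugate given by an
  explicit form.
\<close>
lemma galois_conjugate_sym:
  assumes "quadratic_irrational x" "galois_conjugate x = y" "conjugate_pair D y z"
  shows "x = z"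
proof -
  obtain D' where "conjugate_pair D' x y" using conjugate_pair_exists assms(1,2) by metis
  moreover have "y \<notin> \<rat>" using galois_conjugate_irrational(1) assms(1,2) by metis
  ultimately show ?thesis
    using conjugate_pair_galois(2)[OF conjugate_pair_sym] conjugate_pair_galois(2)[OF assms(3)]
    by metis
qed

text \<open>
  The points with conjugates \<open>1 - \<tau>\<close> and \<open>-\<tau>\<close> are \<open>\<tau> > 1\<close> and \<open>\<tau> - 1 > 1/2\<close>. They lie outside
  the domains of the Odd and the Nearest Integer map respectively, which settles the boundary
  condition for these maps.
\<close>
lemma conjugate_pair_tau: "conjugate_pair 5 (1 - tau) tau" "conjugate_pair 5 (- tau) (tau - 1)"
proof -
  have sq: "tau * tau = tau + 1" using tau_square by (simp add: power2_eq_square)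
  show "conjugate_pair 5 (1 - tau) tau" unfolding conjugate_pair_def
    by (rule exI[of _ 1], rule exI[of _ "-1"], rule exI[of _ "-1"]) (simp add: algebra_simps sq)
  show "conjugate_pair 5 (- tau) (tau - 1)" unfolding conjugate_pair_def
    by (rule exI[of _ 1], rule exI[of _ 1], rule exI[of _ "-1"]) (simp add: algebra_simps sq)
qed

lemma inverse_gt:
  fixes x r :: real
  assumes "x \<in> {-r..r}" "x \<notin> \<rat>" "r \<in> \<rat>"
  shows "\<bar>inverse x\<bar> > inverse r"
proof -
  have "\<bar>x\<bar> \<noteq> r" using assms(2,3) by (auto simp: abs_if split: if_splits)
  moreover have "x \<noteq> 0" using assms(2) by auto
  ultimately have "0 < \<bar>x\<bar>" "\<bar>x\<bar> < r" using assms(1) by auto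
  then show ?thesis by (simp add: less_imp_inverse_less)
qed

lemma nearest_even_facts:
  assumes "y \<notin> \<rat>" "1 < y"
  shows "even (nearest even y)" "\<bar>y - of_int (nearest even y)\<bar> \<le> 1" "2 \<le> nearest even y"
proof -
  define n where "n = nearest even y"
  have n: "n = 2 * round (y / 2)" unfolding n_def by (rule nearest_even_irrational[OF assms(1)])
  then show e: "even (nearest even y)" by (simp add: n_def)
  show a: "\<bar>y - of_int (nearest even y)\<bar> \<le> 1"
    using of_int_round_abs_le[of "y / 2"] unfolding n_def[symmetric] n by (simp add: abs_if split: if_splits)
  then have "0 < nearest even y" using assms(2) by linarith
  then show "2 \<le> nearest even y" using e by presburger
qed

lemma nearest_odd_facts:
  assumes "y \<notin> \<rat>" "1 < y"
  shows "odd (nearest odd y)" "\<bar>y - of_int (nearest odd y)\<bar> \<le> 1" "1 \<le> nearest odd y"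
proof -
  define n where "n = nearest odd y"
  have n: "n = 2 * round ((y - 1) / 2) + 1" unfolding n_def by (rule nearest_odd_irrational[OF assms(1)])
  then show e: "odd (nearest odd y)" by (simp add: n_def)
  show a: "\<bar>y - of_int (nearest odd y)\<bar> \<le> 1"
    using of_int_round_abs_le[of "(y - 1) / 2"] unfolding n_def[symmetric] n
    by (simp add: abs_if field_simps split: if_splits)
  then show "1 \<le> nearest odd y" using assms(2) by linarith
qed

interpretation even_cf: folded_expansion "\<lambda>x. nearest even \<bar>inverse x\<bar>" 1 1 1
proof
  fix x :: real assume x: "x \<in> {-1..1}" "x \<notin> \<rat>"
  note facts = nearest_even_facts[OF inverse_irrational[OF x(2)]]
  have gt: "1 < \<bar>inverse x\<bar>" using inverse_gt[OF x] by simp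
  show "\<bar>\<bar>inverse x\<bar> - of_int (nearest even \<bar>inverse x\<bar>)\<bar> \<le> 1" using facts(2) gt .
  show "1 + 1 / 1 \<le> real_of_int (nearest even \<bar>inverse x\<bar>)"
    "1 + 1 / 1 \<le> real_of_int (nearest even \<bar>inverse x\<bar>)" using facts(3)[OF gt] by simp_all
  fix x' :: real assume x': "x' \<in> {-1..1}" "x' \<notin> \<rat>"
    and less: "nearest even \<bar>inverse x\<bar> < nearest even \<bar>inverse x'\<bar>"
  have "even (nearest even \<bar>inverse x'\<bar>)"
    using nearest_even_facts(1)[OF inverse_irrational[OF x'(2)]] inverse_gt[OF x'] by simp
  then have "nearest even \<bar>inverse x\<bar> + 2 \<le> nearest even \<bar>inverse x'\<bar>"
    using facts(1)[OF gt] less by presburger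
  then show "1 / 1 + 1 / 1 \<le> real_of_int (nearest even \<bar>inverse x'\<bar>) - real_of_int (nearest even \<bar>inverse x\<bar>)"
    by linarith
next
  fix x assume "quadratic_irrational x"
  from galois_conjugate_irrational(1)[OF this] show "galois_conjugate x \<noteq> -1" by auto
qed simp_all

text \<open>
  A negative remainder means that the digit exceeds \<open>\<bar>1/x\<bar> > 1\<close>, so it cannot be 1. The
  digit 1 occurs only before positive points, which explains their larger fibre.
\<close>
interpretation odd_cf: folded_expansion "\<lambda>x. nearest odd \<bar>inverse x\<bar>" 1 "tau + 1" "tau - 1"
proof
  fix x :: real assume x: "x \<in> {-1..1}" "x \<notin> \<rat>"
  note facts = nearest_odd_facts[OF inverse_irrational[OF x(2)]]
  have gt: "1 < \<bar>inverse x\<bar>" using inverse_gt[OF x] by simp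
  show "\<bar>\<bar>inverse x\<bar> - of_int (nearest odd \<bar>inverse x\<bar>)\<bar> \<le> 1" using facts(2) gt .
  show "tau - 1 + 1 / (tau + 1) \<le> real_of_int (nearest odd \<bar>inverse x\<bar>)"
    using facts(3)[OF gt] by (simp add: tau_inverses)
  show "tau + 1 + 1 / (tau + 1) \<le> real_of_int (nearest odd \<bar>inverse x\<bar>)"
    if "\<bar>inverse x\<bar> < real_of_int (nearest odd \<bar>inverse x\<bar>)"
  proof -
    have "1 < nearest odd \<bar>inverse x\<bar>" using that gt by linarith
    then have "3 \<le> nearest odd \<bar>inverse x\<bar>" using facts(1)[OF gt] by presburger
    then show ?thesis by (simp add: tau_inverses)
  qed
  fix x' :: real assume x': "x' \<in> {-1..1}" "x' \<notin> \<rat>"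
    and less: "nearest odd \<bar>inverse x\<bar> < nearest odd \<bar>inverse x'\<bar>"
  have "odd (nearest odd \<bar>inverse x'\<bar>)"
    using nearest_odd_facts(1)[OF inverse_irrational[OF x'(2)]] inverse_gt[OF x'] by simp
  then have "nearest odd \<bar>inverse x\<bar> + 2 \<le> nearest odd \<bar>inverse x'\<bar>"
    using facts(1)[OF gt] less by presburger
  then show "1 / (tau + 1) + 1 / (tau - 1) \<le>
      real_of_int (nearest odd \<bar>inverse x'\<bar>) - real_of_int (nearest odd \<bar>inverse x\<bar>)"
    unfolding tau_inverses by linarith
next
  fix x :: real assume x: "x \<in> {-1..1}" "quadratic_irrational x"
  show "galois_conjugate x \<noteq> - (tau - 1)"
  proof
    assume "galois_conjugate x = - (tau - 1)"
    then have "x = tau" using galois_conjugate_sym[OF x(2) _ conjugate_pair_tau(1)] by simp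
    with x tau_bounds show False by simp
  qed
qed (use tau_bounds in simp_all)

text \<open>
  Here \<open>\<bar>1/x\<bar> > 2\<close>, so the smallest digit 2 occurs only with a positive remainder.
\<close>
interpretation nearest_integer_cf:
  folded_expansion "\<lambda>x. round \<bar>inverse x\<bar>" "1/2" "tau + 1" tau
proof
  fix x :: real assume x: "x \<in> {- (1/2)..1/2}" "x \<notin> \<rat>"
  have gt: "2 < \<bar>inverse x\<bar>" using inverse_gt[OF x] by simp
  show rem: "\<bar>\<bar>inverse x\<bar> - of_int (round \<bar>inverse x\<bar>)\<bar> \<le> 1/2"
    using of_int_round_abs_le[of "\<bar>inverse x\<bar>"] by (simp add: abs_minus_commute)
  have "2 \<le> round \<bar>inverse x\<bar>" using rem gt by linarith
  then show "tau + 1 / (tau + 1) \<le> real_of_int (round \<bar>inverse x\<bar>)"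
    by (simp add: tau_inverses)
  show "tau + 1 + 1 / (tau + 1) \<le> real_of_int (round \<bar>inverse x\<bar>)"
    if "\<bar>inverse x\<bar> < real_of_int (round \<bar>inverse x\<bar>)"
  proof -
    have "3 \<le> round \<bar>inverse x\<bar>" using that gt by linarith
    then show ?thesis by (simp add: tau_inverses)
  qed
  fix x' :: real assume "round \<bar>inverse x\<bar> < round \<bar>inverse x'\<bar>"
  then show "1 / (tau + 1) + 1 / tau \<le>
      real_of_int (round \<bar>inverse x'\<bar>) - real_of_int (round \<bar>inverse x\<bar>)"
    unfolding tau_inverses by linarith
next
  fix x :: real assume x: "x \<in> {- (1/2)..1/2}" "quadratic_irrational x"
  show "galois_conjugate x \<noteq> - tau"
  proof
    assume "galois_conjugate x = - tau"
    then have "x = tau - 1" using galois_conjugate_sym[OF x(2) _ conjugate_pair_tau(2)] by simp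
    with x tau_bounds show False by simp
  qed
qed (use tau_bounds in simp_all)

section \<open>The Ceiling and Farey maps\<close>

text \<open>
  The image \<open>\<lceil>1/x\<rceil> - 1/y\<close> of a conjugate \<open>y > 1\<close> lies in the unit interval that ends at the digit, so
  it determines the digit.
\<close>
interpretation ceiling_cf: moebius_expansion ceiling_map "{0..1}" "\<lambda>_. {1..}"
  "\<lambda>x. \<lceil>inverse x\<rceil>" "\<lambda>_. -1" "\<lambda>_. 1" "\<lambda>_. 0"
proof
  fix x :: real assume x: "x \<in> {0..1}" "x \<notin> \<rat>"
  then have x01: "0 < x" "x < 1" by (auto simp: less_le)
  then have "1 < inverse x" by (simp add: one_less_inverse_iff)
  then have d: "2 \<le> \<lceil>inverse x\<rceil>" by linarith
  show "ceiling_map x = moebius \<lceil>inverse x\<rceil> (-1) 1 0 x"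
    using x01 by (simp add: ceiling_map_def moebius_def field_simps)
  show "ceiling_map x \<in> {0..1}" unfolding ceiling_map_def atLeastAtMost_iff by linarith
  show "\<bar>real_of_int 1 * x + real_of_int 0\<bar> < 1" using x01 by simp
  show "\<exists>n. n \<noteq> 0 \<and> x + real_of_int n \<in> {1..}" using x01 by (intro exI[of _ 1]) simp
  fix y :: real assume "y \<in> {1..}" "y \<notin> \<rat>"
  then have y: "1 < y" by (auto simp: less_le)
  then have "1 / y < 1" by simp
  then have "1 \<le> of_int \<lceil>inverse x\<rceil> - 1 / y" using d by linarith
  then show "moebius \<lceil>inverse x\<rceil> (-1) 1 0 y \<in> {1..}"
    using y by (simp add: moebius_def field_simps)
  show "\<lfloor>x\<rfloor> \<noteq> \<lfloor>y\<rfloor>"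
  proof -
    have "\<lfloor>x\<rfloor> < 1" using x01 by (simp add: floor_less_iff)
    moreover have "1 \<le> \<lfloor>y\<rfloor>" using y by (simp add: le_floor_iff)
    ultimately show ?thesis by linarith
  qed
next
  fix x x' :: real
  assume q: "quadratic_irrational x" "quadratic_irrational x'"
    and fib: "galois_conjugate x \<in> {1..}" "galois_conjugate x' \<in> {1..}"
    and T: "ceiling_map x = ceiling_map x'"
    and br: "moebius \<lceil>inverse x\<rceil> (-1) 1 0 (galois_conjugate x) =
      moebius \<lceil>inverse x'\<rceil> (-1) 1 0 (galois_conjugate x')"
  define y y' where "y = galois_conjugate x" and "y' = galois_conjugate x'"
  have y: "1 < y" "1 < y'"
    using fib galois_conjugate_irrational(1)[OF q(1)] galois_conjugate_irrational(1)[OF q(2)]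
    by (auto simp: y_def y'_def less_le)
  have "of_int \<lceil>inverse x\<rceil> - 1 / y = of_int \<lceil>inverse x'\<rceil> - 1 / y'"
    using br y by (simp add: moebius_def y_def[symmetric] y'_def[symmetric] diff_divide_distrib)
  moreover have "0 < 1 / y" "1 / y < 1" "0 < 1 / y'" "1 / y' < 1" using y by auto
  ultimately have "\<lceil>inverse x\<rceil> = \<lceil>inverse x'\<rceil>" by linarith
  with T show "x = x'" by (simp add: ceiling_map_def)
qed simp_all

lemma farey_map_eq:
  assumes "0 < x" "x < 1"
  shows "farey_map x = (if x < 1/2 then x / (1 - x) else (1 - x) / x)"
proof -
  have "x / (1 - x) \<le> (1 - x) / x \<longleftrightarrow> x * x \<le> (1 - x) * (1 - x)"
    using assms by (simp add: field_simps)
  also have "\<dots> \<longleftrightarrow> x \<le> 1/2" by (simp add: algebra_simps)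
  finally have "x / (1 - x) \<le> (1 - x) / x \<longleftrightarrow> x \<le> 1/2" .
  then have "farey_map x = (if x \<le> 1/2 then x / (1 - x) else (1 - x) / x)"
    unfolding farey_map_def min_def divide_inverse by simp
  moreover have "x / (1 - x) = (1 - x) / x" if "x = 1/2" unfolding that by simp
  ultimately show ?thesis by (simp add: order_le_less)
qed

text \<open>
  The two branches send the negative half-line to the disjoint intervals \<open>{-1<..<0}\<close> and \<open>{..<-1}\<close>.
  The first branch fixes 0 with slope 1, so it expands at the positive points, but not uniformly.
\<close>
interpretation farey_cf: moebius_expansion farey_map "{0..1}" "\<lambda>_. {..0}"
  "\<lambda>x. if x < 1/2 then 1 else -1" "\<lambda>x. if x < 1/2 then 0 else 1"
  "\<lambda>x. if x < 1/2 then -1 else 1" "\<lambda>x. if x < 1/2 then 1 else 0"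
proof
  fix x :: real assume x: "x \<in> {0..1}" "x \<notin> \<rat>"
  then have x01: "0 < x" "x < 1" by (auto simp: less_le)
  show "farey_map x = moebius (if x < 1/2 then 1 else -1) (if x < 1/2 then 0 else 1)
      (if x < 1/2 then -1 else 1) (if x < 1/2 then 1 else 0) x"
    using x01 by (simp add: farey_map_eq moebius_def)
  show "farey_map x \<in> {0..1}"
    using x01 by (auto simp: farey_map_eq field_simps)
  show "\<bar>real_of_int (if x < 1/2 then -1 else 1) * x + real_of_int (if x < 1/2 then 1 else 0)\<bar> < 1"
    using x01 by simp
  show "\<exists>n. n \<noteq> 0 \<and> x + real_of_int n \<in> {..0}" using x01 by (intro exI[of _ "-1"]) simp
  fix y :: real assume "y \<in> {..0}" "y \<notin> \<rat>"
  then have y: "y < 0" by (auto simp: less_le)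
  then show "moebius (if x < 1/2 then 1 else -1) (if x < 1/2 then 0 else 1)
      (if x < 1/2 then -1 else 1) (if x < 1/2 then 1 else 0) y \<in> {..0}"
    by (simp add: moebius_def field_simps)
  show "\<lfloor>x\<rfloor> \<noteq> \<lfloor>y\<rfloor>"
  proof -
    have "0 \<le> \<lfloor>x\<rfloor>" using x01 by simp
    moreover have "\<lfloor>y\<rfloor> < 0" using y by (simp add: floor_less_iff)
    ultimately show ?thesis by linarith
  qed
next
  fix x x' :: real
  assume x: "x \<in> {0..1}" "x' \<in> {0..1}"
    and q: "quadratic_irrational x" "quadratic_irrational x'"
    and fib: "galois_conjugate x \<in> {..0}" "galois_conjugate x' \<in> {..0}"
    and T: "farey_map x = farey_map x'"
    and br: "moebius (if x < 1/2 then 1 else -1) (if x < 1/2 then 0 else 1)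
        (if x < 1/2 then -1 else 1) (if x < 1/2 then 1 else 0) (galois_conjugate x) =
      moebius (if x' < 1/2 then 1 else -1) (if x' < 1/2 then 0 else 1)
        (if x' < 1/2 then -1 else 1) (if x' < 1/2 then 1 else 0) (galois_conjugate x')"
  define y y' where "y = galois_conjugate x" and "y' = galois_conjugate x'"
  have y: "y < 0" "y' < 0"
    using fib galois_conjugate_irrational(1)[OF q(1)] galois_conjugate_irrational(1)[OF q(2)]
    by (auto simp: y_def y'_def less_le)
  have irr: "x \<notin> \<rat>" "x' \<notin> \<rat>" using q by (auto simp: quadratic_irrational_def)
  have x01: "0 < x" "x < 1" "0 < x'" "x' < 1" using x irr by (auto simp: less_le)
  have low: "- 1 < z / (1 - z)" if "z < 0" for z :: real using that by (simp add: field_simps)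
  have high: "(1 - z) / z < - 1" if "z < 0" for z :: real using that by (simp add: field_simps)
  have branch: "(if x < 1/2 then y / (1 - y) else (1 - y) / y) =
      (if x' < 1/2 then y' / (1 - y') else (1 - y') / y')"
    using br unfolding y_def[symmetric] y'_def[symmetric]
    by (cases "x < 1/2"; cases "x' < 1/2"; simp add: moebius_def)
  have same: "x < 1/2 \<longleftrightarrow> x' < 1/2"
    using branch low[OF y(1)] low[OF y(2)] high[OF y(1)] high[OF y(2)]
    by (cases "x < 1/2"; cases "x' < 1/2"; simp)
  show "x = x'"
  proof (cases "x < 1/2")
    case True
    then have "x / (1 - x) = x' / (1 - x')" using T same x01 by (simp add: farey_map_eq)
    then have "x * (1 - x') = x' * (1 - x)" using x01 by (simp add: frac_eq_eq)
    then show ?thesis by (simp add: algebra_simps)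
  next
    case False
    then have "(1 - x) / x = (1 - x') / x'" using T same x01 by (simp add: farey_map_eq)
    then have "(1 - x) * x' = (1 - x') * x" using x01 by (simp add: frac_eq_eq)
    then show ?thesis by (simp add: algebra_simps)
  qed
qed simp_all

theorem corollary1p3:
  fixes \<omega> :: real
  assumes "quadratic_irrational \<omega>"
  shows
    "(\<omega> \<in> {0..1} \<longrightarrow>
        (purely_periodic farey_map \<omega> \<longleftrightarrow> galois_conjugate \<omega> < 0)) \<and>
     (\<omega> \<in> {0..1} \<longrightarrow>
        (purely_periodic ceiling_map \<omega> \<longleftrightarrow> galois_conjugate \<omega> > 1)) \<and>
     (\<omega> \<in> {-1..1} \<longrightarrow>
        (purely_periodic even_map \<omega> \<longleftrightarrow> galois_conjugate \<omega> < -1)) \<and>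
     (\<omega> \<in> {-1..1} \<longrightarrow>
        (purely_periodic odd_map \<omega> \<longleftrightarrow>
          (\<omega> < 0 \<and> galois_conjugate \<omega> \<le> - tau - 1 \<or>
           \<omega> > 0 \<and> galois_conjugate \<omega> \<le> - tau + 1))) \<and>
     (\<omega> \<in> {-1/2..1/2} \<longrightarrow>
        (purely_periodic nearest_integer_map \<omega> \<longleftrightarrow>
          (\<omega> < 0 \<and> galois_conjugate \<omega> \<le> - tau - 1 \<or>
           \<omega> > 0 \<and> galois_conjugate \<omega> \<le> - tau)))"
proof (intro conjI impI)
  have irr: "galois_conjugate \<omega> \<notin> \<rat>" by (rule galois_conjugate_irrational(1)[OF assms])
  then have ne: "galois_conjugate \<omega> \<noteq> 0" "galois_conjugate \<omega> \<noteq> 1" "galois_conjugate \<omega> \<noteq> -1" by auto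
  have \<omega>: "\<omega> \<noteq> 0" using assms by (auto simp: quadratic_irrational_def)
  show "purely_periodic farey_map \<omega> \<longleftrightarrow> galois_conjugate \<omega> < 0" if "\<omega> \<in> {0..1}"
    using farey_cf.purely_periodic_iff[OF that assms] ne by auto
  show "purely_periodic ceiling_map \<omega> \<longleftrightarrow> galois_conjugate \<omega> > 1" if "\<omega> \<in> {0..1}"
    using ceiling_cf.purely_periodic_iff[OF that assms] ne by auto
  have "even_map = (\<lambda>x. \<bar>inverse x\<bar> - of_int (nearest even \<bar>inverse x\<bar>))"
    by (rule ext) (rule even_map_def)
  then show "purely_periodic even_map \<omega> \<longleftrightarrow> galois_conjugate \<omega> < -1" if "\<omega> \<in> {-1..1}"
    using even_cf.periodic_iff_threshold[OF that assms] ne \<omega> by auto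
  have "odd_map = (\<lambda>x. \<bar>inverse x\<bar> - of_int (nearest odd \<bar>inverse x\<bar>))"
    by (rule ext) (rule odd_map_def)
  then show "purely_periodic odd_map \<omega> \<longleftrightarrow>
      (\<omega> < 0 \<and> galois_conjugate \<omega> \<le> - tau - 1 \<or> \<omega> > 0 \<and> galois_conjugate \<omega> \<le> - tau + 1)"
    if "\<omega> \<in> {-1..1}"
    using odd_cf.periodic_iff_threshold[OF that assms] by simp
  have "nearest_integer_map = (\<lambda>x. \<bar>inverse x\<bar> - of_int (round \<bar>inverse x\<bar>))"
    by (rule ext) (rule nearest_integer_map_def)
  then show "purely_periodic nearest_integer_map \<omega> \<longleftrightarrow>
      (\<omega> < 0 \<and> galois_conjugate \<omega> \<le> - tau - 1 \<or> \<omega> > 0 \<and> galois_conjugate \<omega> \<le> - tau)"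
    if "\<omega> \<in> {-1/2..1/2}"
    using nearest_integer_cf.periodic_iff_threshold[of \<omega>] that assms by simp
qed

end
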